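(* Let $p$ be a prime number and let $\overline{\mathbf{F}}_p$ be an algebraic closure of $\mathbf{F}_p$. For every prime $\ell \neq p$, there exist an automorphism $\sigma \in \mathrm{Gal}(\overline{\mathbf{F}}_p/\mathbf{F}_p)$ and a modular polynomial $P(T) \in \mathbf{Z}[T]$ such that the $\ell$-primary torsion subgroup of $\mathbf{G}_m(\overline{\mathbf{F}}_p)$, i.e. $\{x \in \overline{\mathbf{F}}_p^\times : x^{\ell^n} = 1 \text{ for some } n \geq 0\}$, is contained in $\ker P(\sigma) \subset \mathbf{G}_m(\overline{\mathbf{F}}_p)$.
   Context: A $p$-Weil number is an algebraic number $\alpha$ for which there is a rational number $r$ such that all archimedean absolute values of $\alpha$ (that is, $|\iota(\alpha)|$ for every embedding $\iota : \mathbf{Q}(\alpha) \to \mathbf{C}$) are equal to $p^r$. A polynomial $P(T) \in \mathbf{Z}[T]$ is called modular if none of its roots (in an algebraic closure of $\mathbf{Q}$) is a $p$-Weil number; in particular the zero polynomial is not modular. For $\sigma \in \mathrm{Gal}(\overline{\mathbf{F}}_p/\mathbf{F}_p)$, $\sigma$ acts as a group endomorphism of $\mathbf{G}_m(\overline{\mathbf{F}}_p) = \overline{\mathbf{F}}_p^\times$. For $P(T) = \sum_i c_i T^i \in \mathbf{Z}[T]$, $P(\sigma)$ denotes the image of $P$ under the ring homomorphism $\mathbf{Z}[T] \to \mathrm{End}(\overline{\mathbf{F}}_p^\times)$ sending $T$ to $\sigma$; written multiplicatively, $P(\sigma)(x) = \prod_i \sigma^i(x)^{c_i}$. *)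

theory Defs
  imports "HOL-Computational_Algebra.Computational_Algebra"
begin

text \<open>
  An algebraic closure of $\mathbf{F}_p$ is a type of sort \<open>alg_closed_field\<close> with
  \<open>CHAR('k) = p\<close> all of whose elements are algebraic over the prime field. In characteristic
  \<open>p\<close> the prime field $\mathbf{F}_p$ is the set \<open>\<int> = range of_int\<close>.
\<close>

definition algebraic_over_prime_field :: "'k::field \<Rightarrow> bool" where
  "algebraic_over_prime_field x \<longleftrightarrow>
     (\<exists>q :: 'k poly. q \<noteq> 0 \<and> (\<forall>i. coeff q i \<in> \<int>) \<and> poly q x = 0)"

definition Gal_prime_field :: "('k::field \<Rightarrow> 'k) set" where
  "Gal_prime_field = {\<sigma>. bij \<sigma> \<and> (\<forall>x y. \<sigma> (x + y) = \<sigma> x + \<sigma> y) \<and>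
     (\<forall>x y. \<sigma> (x * y) = \<sigma> x * \<sigma> y) \<and> (\<forall>c\<in>\<int>. \<sigma> c = c)}"

text \<open>
  The multiplicative group $\mathbf{G}_m$ of a field is represented by its nonzero elements.
  The value of \<open>poly_endo P \<sigma>\<close> at \<open>0\<close> has no meaning and is excluded from the kernel.
\<close>

definition poly_endo :: "int poly \<Rightarrow> ('k::field \<Rightarrow> 'k) \<Rightarrow> 'k \<Rightarrow> 'k" where
  "poly_endo P \<sigma> x = (\<Prod>i\<le>degree P. ((\<sigma> ^^ i) x) powi (coeff P i))"

definition ker_poly_endo :: "int poly \<Rightarrow> ('k::field \<Rightarrow> 'k) \<Rightarrow> 'k set" where
  "ker_poly_endo P \<sigma> = {x. x \<noteq> 0 \<and> poly_endo P \<sigma> x = 1}"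

definition Gm_primary_torsion :: "nat \<Rightarrow> 'k::field set" where
  "Gm_primary_torsion l = {x. x \<noteq> 0 \<and> (\<exists>n. x ^ (l ^ n) = 1)}"

definition is_subfield :: "'k::field set \<Rightarrow> bool" where
  "is_subfield K \<longleftrightarrow> 0 \<in> K \<and> 1 \<in> K \<and>
     (\<forall>x\<in>K. \<forall>y\<in>K. x + y \<in> K \<and> x * y \<in> K) \<and> (\<forall>x\<in>K. - x \<in> K \<and> inverse x \<in> K)"

text \<open>$\mathbf{Q}(\alpha)$ as a subfield of $\mathbf{C}$; every subfield contains $\mathbf{Q}$.\<close>

definition rat_adjoin :: "complex \<Rightarrow> complex set" where
  "rat_adjoin \<alpha> = is_subfield hull {\<alpha>}"

text \<open>
  Ring homomorphisms \<open>K \<rightarrow> \<complex>\<close>, given by functions whose values outside \<open>K\<close> are irrelevant.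
\<close>

definition complex_embedding :: "complex set \<Rightarrow> (complex \<Rightarrow> complex) \<Rightarrow> bool" where
  "complex_embedding K \<iota> \<longleftrightarrow> \<iota> 1 = 1 \<and>
     (\<forall>x\<in>K. \<forall>y\<in>K. \<iota> (x + y) = \<iota> x + \<iota> y \<and> \<iota> (x * y) = \<iota> x * \<iota> y)"

text \<open>
  The algebraic elements of $\mathbf{C}$ form an algebraic closure of $\mathbf{Q}$, and it is there
  that algebraic numbers and the roots of integer polynomials are taken. Only algebraic
  \<open>\<alpha>\<close> can be Weil numbers, so transcendental complex roots (of the zero polynomial) play no role.
\<close>

definition weil_number :: "nat \<Rightarrow> complex \<Rightarrow> bool" where
  "weil_number p \<alpha> \<longleftrightarrow> algebraic \<alpha> \<and>
     (\<exists>r::rat. \<forall>\<iota>. complex_embedding (rat_adjoin \<alpha>) \<iota> \<longrightarrow>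
        cmod (\<iota> \<alpha>) = real p powr real_of_rat r)"

definition modular_poly :: "nat \<Rightarrow> int poly \<Rightarrow> bool" where
  "modular_poly p P \<longleftrightarrow>
     (\<forall>\<alpha>::complex. poly (map_poly of_int P) \<alpha> = 0 \<longrightarrow> \<not> weil_number p \<alpha>)"

end

theory Submission
  imports
    Defs
    "HOL-Number_Theory.Residues"
    "HOL-Library.Diagonal_Subsequence"
begin

text \<open>
  On the \<open>l\<close>-primary torsion a Galois element acts as exponentiation by an element of the closure
  of the powers of \<open>p\<close> in the \<open>l\<close>-adic units, and this closure contains \<open>1 + l ^ k * \<int>\<^sub>l\<close> for
  some \<open>k\<close>. Hence it contains the integer \<open>u = 1 + p * l ^ k\<close>, which is prime to \<open>p\<close> and larger
  than \<open>1\<close>, so that no rational power of \<open>p\<close> equals it. The polynomial \<open>T - u\<close> is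
  therefore modular, and it annihilates the torsion for a \<open>\<sigma>\<close> acting on it as \<open>x \<mapsto> x ^ u\<close>. Such
  a \<open>\<sigma>\<close> is a pointwise limit of powers of Frobenius.
\<close>

section \<open>Powers of an integer modulo powers of a prime\<close>

lemma one_plus_power_expansion:
  fixes y :: int
  shows "\<exists>z. (1 + y) ^ n = 1 + of_nat n * y + y\<^sup>2 * z"
proof (induction n)
  case 0
  show ?case by (intro exI[of _ 0]) simp
next
  case (Suc n)
  then obtain z where "(1 + y) ^ n = 1 + of_nat n * y + y\<^sup>2 * z" ..
  then have "(1 + y) ^ Suc n = 1 + of_nat (Suc n) * y + y\<^sup>2 * (of_nat n + z + y * z)"
    by (simp add: algebra_simps power2_eq_square)
  then show ?case ..
qed

text \<open>
  Taking \<open>k \<ge> 2\<close> instead of \<open>k \<ge> 1\<close> makes the quadratic remainder of the binomial expansion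
  negligible without any divisibility of binomial coefficients, and covers \<open>l = 2\<close> uniformly.
\<close>

lemma power_prime_power_exact:
  fixes g c :: int and l :: nat
  assumes g: "g = 1 + int l ^ k * c" and k: "k \<ge> 2" and c: "\<not> int l dvd c"
  shows "\<exists>c'. g ^ (l ^ j) = 1 + int l ^ (k + j) * c' \<and> \<not> int l dvd c'"
proof (induction j)
  case 0
  show ?case using g c by auto
next
  case (Suc j)
  then obtain c' where c': "g ^ (l ^ j) = 1 + int l ^ (k + j) * c'" "\<not> int l dvd c'"
    by blast
  obtain m where m: "k + j = Suc (Suc m)"
    using k by (metis add_2_eq_Suc le_add1 le_iff_add le_trans)
  obtain z where z: "(1 + int l ^ (k + j) * c') ^ l =
      1 + int l * (int l ^ (k + j) * c') + (int l ^ (k + j) * c')\<^sup>2 * z"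
    using one_plus_power_expansion[of "int l ^ (k + j) * c'" l] by auto
  have "g ^ (l ^ Suc j) = (g ^ (l ^ j)) ^ l"
    by (simp add: power_mult [symmetric] mult.commute)
  also have "\<dots> = 1 + int l ^ (k + Suc j) * (c' + int l * (int l ^ m * c'\<^sup>2 * z))"
    unfolding c' z using m by (simp add: algebra_simps power2_eq_square)
  finally have "g ^ (l ^ Suc j) = 1 + int l ^ (k + Suc j) * (c' + int l * (int l ^ m * c'\<^sup>2 * z))" .
  moreover have "\<not> int l dvd c' + int l * (int l ^ m * c'\<^sup>2 * z)"
    using c'(2) by (simp add: dvd_add_left_iff)
  ultimately show ?case by blast
qed

text \<open>Hensel-style lifting. If \<open>g ^ a\<close> misses \<open>u\<close> by
  \<open>l ^ (k + j) * t\<close>, then multiplying it by \<open>(g ^ (l ^ j)) ^ b\<close> adds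
  \<open>g ^ a * c' * b * l ^ (k + j)\<close> up to higher order. As \<open>g ^ a * c'\<close> is a
  unit modulo \<open>l\<close>, some \<open>b\<close> cancels \<open>t\<close> modulo
  \<open>l\<close>.\<close>

lemma power_cong_one_plus:
  fixes g c u :: int and l :: nat
  assumes l: "prime l" and g: "g = 1 + int l ^ k * c" and k: "k \<ge> 2" and c: "\<not> int l dvd c"
    and u: "[u = 1] (mod int l ^ k)"
  shows "\<exists>a. [g ^ a = u] (mod int l ^ (k + j))"
proof (induction j)
  case 0
  show ?case using cong_sym[OF u] by (intro exI[of _ 0]) simp
next
  case (Suc j)
  then obtain a where a: "[g ^ a = u] (mod int l ^ (k + j))" ..
  then obtain t where t: "u = g ^ a + int l ^ (k + j) * t"
    by (metis cong_iff_lin)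
  obtain c' where c': "g ^ (l ^ j) = 1 + int l ^ (k + j) * c'" "\<not> int l dvd c'"
    using power_prime_power_exact[OF g k c] by blast
  have pl: "prime (int l)" using l by simp
  have "int l dvd int l ^ k * c" using k by simp
  moreover have "\<not> int l dvd 1" using pl not_prime_unit by blast
  ultimately have "\<not> int l dvd g"
    unfolding g using dvd_add_left_iff by blast
  then have "\<not> int l dvd g ^ a * c'"
    using c'(2) pl prime_dvd_mult_iff prime_dvd_power by blast
  then have "coprime (g ^ a * c') (int l)"
    using pl by (metis coprime_commute prime_imp_coprime)
  then obtain x where x: "[g ^ a * c' * x = 1] (mod int l)"
    using cong_solve_coprime_int by blast
  \<comment> \<open>Reduction modulo \<open>l\<close> makes the solution \<open>x * t\<close>
    nonnegative, as an exponent has to be.\<close>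
  define b where "b = nat ((x * t) mod int l)"
  have "int b = (x * t) mod int l"
    unfolding b_def using l prime_gt_0_nat by simp
  then have "[int b = x * t] (mod int l)" by simp
  then have "[g ^ a * c' * int b = g ^ a * c' * (x * t)] (mod int l)"
    by (rule cong_scalar_left)
  also have "[g ^ a * c' * (x * t) = 1 * t] (mod int l)"
    using cong_scalar_right[OF x, of t] by (simp add: mult_ac)
  finally obtain s where s: "t = g ^ a * c' * int b + int l * s"
    by (metis cong_iff_lin mult_1)
  obtain z where z: "(1 + int l ^ (k + j) * c') ^ b =
      1 + int b * (int l ^ (k + j) * c') + (int l ^ (k + j) * c')\<^sup>2 * z"
    using one_plus_power_expansion[of "int l ^ (k + j) * c'" b] by auto
  \<comment> \<open>Since \<open>2 * (k + j) = (k + Suc j) + m\<close>, the quadratic remainder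
    vanishes modulo \<open>l ^ (k + Suc j)\<close>.\<close>
  obtain m where m: "k + j = Suc m"
    using k by (cases "k + j") auto
  have "g ^ (a + l ^ j * b) = g ^ a * (g ^ (l ^ j)) ^ b"
    by (simp add: power_add power_mult)
  also have "\<dots> = u + int l ^ (k + Suc j) * (g ^ a * int l ^ m * c'\<^sup>2 * z - s)"
    unfolding c' z t s using m by (simp add: algebra_simps power2_eq_square)
  finally have "[g ^ (a + l ^ j * b) = u] (mod int l ^ (k + Suc j))"
    by (simp add: cong_iff_dvd_diff)
  then show ?case ..
qed

lemma ex_power_cong_primes:
  fixes p l :: nat
  assumes "prime p" "prime l" "l \<noteq> p"
  shows "\<exists>k. \<forall>u. [u = 1] (mod l ^ k) \<longrightarrow> (\<forall>n. \<exists>a. [p ^ a = u] (mod l ^ n))"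
proof -
  \<comment> \<open>Euler's theorem modulo \<open>l\<^sup>2\<close>, not just modulo
    \<open>l\<close>, secures the bound \<open>k \<ge> 2\<close> needed for lifting.\<close>
  define d where "d = totient (l\<^sup>2)"
  have "coprime p (l\<^sup>2)"
    using assms by (simp add: primes_coprime)
  then have "[p ^ d = 1] (mod l\<^sup>2)"
    unfolding d_def by (rule euler_theorem)
  then have dvd: "int l ^ 2 dvd int p ^ d - 1"
    by (metis cong_iff_dvd_diff cong_int_iff of_nat_1 of_nat_power)
  have "d > 0"
    unfolding d_def using assms(2) prime_gt_0_nat by simp
  then have "p ^ d > 1"
    using prime_gt_1_nat[OF assms(1)] by (intro one_less_power) auto
  \<comment> \<open>Only a nonzero integer has a finite exact \<open>l\<close>-adic valuation
    \<open>k\<close>.\<close>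
  then have nz: "int p ^ d - 1 \<noteq> 0"
    by (metis diff_eq_diff_less_eq eq_iff_diff_eq_0 less_irrefl of_nat_1 of_nat_eq_iff of_nat_power)
  have nu: "\<not> is_unit (int l)" using assms(2) by auto
  define k where "k = multiplicity (int l) (int p ^ d - 1)"
  obtain c where c: "int p ^ d - 1 = int l ^ k * c" "\<not> int l dvd c"
    unfolding k_def using multiplicity_decompose'[OF nz nu] by metis
  have k: "k \<ge> 2"
    unfolding k_def using dvd nz nu by (intro multiplicity_geI) auto
  have "\<exists>a. [p ^ a = u] (mod l ^ n)" if "[u = 1] (mod l ^ k)" for u n
  proof -
    have "[int u = 1] (mod int l ^ k)"
      using \<open>[u = 1] (mod l ^ k)\<close> by (metis cong_int_iff of_nat_1 of_nat_power)
    then obtain a where "[(int p ^ d) ^ a = int u] (mod int l ^ (k + n))"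
      using power_cong_one_plus[OF assms(2) _ k c(2)] c(1)
      by (metis add.commute diff_add_cancel)
    then have "[p ^ (d * a) = u] (mod l ^ (k + n))"
      by (metis cong_int_iff of_nat_power power_mult)
    then have "[p ^ (d * a) = u] (mod l ^ n)"
      by (rule cong_dvd_modulus_nat) (simp add: le_imp_power_dvd)
    then show ?thesis ..
  qed
  then show ?thesis by blast
qed

section \<open>Modularity of linear polynomials\<close>

text \<open>With \<open>r = m / n\<close>, raising to the power \<open>n\<close> gives
  \<open>u ^ n = p ^ m\<close>. Here \<open>m > 0\<close> because \<open>u > 1\<close>, so
  \<open>p\<close> would divide \<open>u\<close>.\<close>

lemma nat_not_rational_power_of_prime:
  fixes p u :: nat and r :: rat
  assumes p: "prime p" and u: "u > 1" "\<not> p dvd u"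
  shows "real u \<noteq> real p powr of_rat r"
proof
  assume eq: "real u = real p powr of_rat r"
  have p0: "real p > 1" using prime_gt_1_nat[OF p] by simp
  obtain m n where r: "r = Rat.Fract m n" "n > 0" by (cases r) auto
  have rr: "real_of_rat r = of_int m / of_int n"
    using r by (simp add: of_rat_rat)
  have "real p powr of_rat r > 1" using u eq by simp
  then have "real_of_rat r > 0"
    using p0 powr_mono[of "real_of_rat r" 0 "real p"] by (cases "real_of_rat r > 0") auto
  then have m: "m > 0"
    using rr r(2) by (simp add: zero_less_divide_iff)
  have "real u ^ nat n = real p powr (of_rat r * of_int n)"
    unfolding eq using r(2) p0 by (simp add: powr_realpow[symmetric] powr_powr)
  also have "of_rat r * of_int n = (of_int m :: real)"
    using rr r(2) by simp
  also have "real p powr of_int m = real p ^ nat m"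
    using m p0 by (simp add: powr_realpow[symmetric])
  finally have "u ^ nat n = p ^ nat m"
    by (metis of_nat_eq_iff of_nat_power)
  moreover have "p dvd p ^ nat m" using m by simp
  ultimately show False
    using p u(2) prime_dvd_power by metis
qed

lemma modular_poly_linear:
  fixes p u :: nat
  assumes "prime p" "u > 1" "\<not> p dvd u"
  shows "modular_poly p [:- int u, 1:]"
  unfolding modular_poly_def
proof (intro allI impI notI)
  fix \<alpha> :: complex
  assume "poly (map_poly of_int [:- int u, 1:]) \<alpha> = 0" and w: "weil_number p \<alpha>"
  then have \<alpha>: "\<alpha> = of_nat u" by (simp add: map_poly_pCons)
  obtain r :: rat where "\<forall>\<iota>. complex_embedding (rat_adjoin \<alpha>) \<iota> \<longrightarrow>
      cmod (\<iota> \<alpha>) = real p powr real_of_rat r"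
    using w unfolding weil_number_def by blast
  \<comment> \<open>The Weil condition holds for every embedding, so the inclusion alone refutes
    it.\<close>
  moreover have "complex_embedding (rat_adjoin \<alpha>) (\<lambda>x. x)"
    by (simp add: complex_embedding_def)
  ultimately have "cmod \<alpha> = real p powr real_of_rat r" by blast
  then show False
    using nat_not_rational_power_of_prime[OF assms, of r] \<alpha> by simp
qed

section \<open>Limits of powers of Frobenius\<close>

text \<open>Sequential compactness of the profinite completion of the integers: for each modulus,
  pigeonhole gives a subsequence with constant residue, and a diagonal subsequence serves all
  moduli.\<close>

lemma ex_subseq_eventually_const_mod:
  fixes a :: "nat \<Rightarrow> nat"
  shows "\<exists>r. strict_mono r \<and> (\<forall>m>0. \<exists>c. \<forall>\<^sub>F n in sequentially. a (r n) mod m = c)"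
proof -
  \<comment> \<open>Stage \<open>m\<close> treats the modulus \<open>Suc m\<close>, since
    \<open>a mod 0 = a\<close> takes infinitely many values in general.\<close>
  interpret subseqs "\<lambda>m s. \<exists>c. \<forall>i. a (s i) mod Suc m = c"
  proof
    fix m and s :: "nat \<Rightarrow> nat"
    have "finite ((\<lambda>i. a (s i) mod Suc m) ` UNIV)"
      by (rule finite_subset[of _ "{..<Suc m}"]) auto
    then obtain i0 where "infinite {i \<in> UNIV. a (s i) mod Suc m = a (s i0) mod Suc m}"
      using pigeonhole_infinite[of UNIV "\<lambda>i. a (s i) mod Suc m"] by blast
    then obtain r :: "nat \<Rightarrow> nat" where "strict_mono r" "\<forall>n. a (s (r n)) mod Suc m = a (s i0) mod Suc m"
      using infinite_enumerate[of "{i \<in> UNIV. a (s i) mod Suc m = a (s i0) mod Suc m}"] by auto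
    then show "\<exists>r' :: nat \<Rightarrow> nat. strict_mono r' \<and> (\<exists>c. \<forall>i. a ((s \<circ> r') i) mod Suc m = c)"
      by (intro exI[of _ r]) auto
  qed
  have "\<exists>c. \<forall>\<^sub>F n in sequentially. a (diagseq n) mod m = c" if "m > 0" for m
  proof -
    have stable: "\<exists>c. \<forall>i. a ((s \<circ> r) i) mod Suc k = c" if "\<exists>c. \<forall>i. a (s i) mod Suc k = c"
      for r s :: "nat \<Rightarrow> nat" and k
      using that unfolding comp_def by blast
    obtain c where "\<And>i. a ((diagseq \<circ> ((+) (Suc (m - 1)))) i) mod Suc (m - 1) = c"
      using diagseq_holds[of "m - 1", OF stable] by blast
    then have c: "a (diagseq (m + i)) mod m = c" for i
      using \<open>m > 0\<close> by simp
    have "\<forall>n\<ge>m. a (diagseq n) mod m = c"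
    proof (intro allI impI)
      fix n assume "m \<le> n"
      then show "a (diagseq n) mod m = c" using c[of "n - m"] by simp
    qed
    then show ?thesis
      unfolding eventually_sequentially by (intro exI[of _ c] exI[of _ m])
  qed
  then show ?thesis using subseq_diagseq by blast
qed

context
  fixes p :: nat
  assumes prime_p: "prime p" and char_p: "CHAR('k::field) = p"
begin

lemma frobenius_power_add: "(x + y :: 'k) ^ (p ^ i) = x ^ (p ^ i) + y ^ (p ^ i)"
  using freshmans_dream'[of "p ^ i" i x y] prime_p char_p by simp

lemma frobenius_power_inj: "(x :: 'k) ^ (p ^ i) = y ^ (p ^ i) \<Longrightarrow> x = y"
proof -
  assume eq: "x ^ (p ^ i) = y ^ (p ^ i)"
  have "((x - y) + y) ^ (p ^ i) = (x - y) ^ (p ^ i) + y ^ (p ^ i)"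
    by (rule frobenius_power_add)
  then have "(x - y) ^ (p ^ i) = 0" using eq by simp
  then show "x = y" by simp
qed

text \<open>Additivity of Frobenius gives this for naturals by induction; an integer equals its
  residue modulo \<open>p\<close> in the field.\<close>

lemma frobenius_power_of_int: "c \<in> \<int> \<Longrightarrow> (c :: 'k) ^ (p ^ i) = c"
proof (induction c rule: Ints_induct)
  case (of_int z)
  have p0: "p > 0" using prime_p prime_gt_0_nat by blast
  have nat: "(of_nat n :: 'k) ^ (p ^ i) = of_nat n" for n
    by (induction n) (use p0 in \<open>simp_all add: frobenius_power_add power_0_left\<close>)
  have "(of_int z :: 'k) = of_int (z mod int p)"
    unfolding of_int_eq_iff_cong_CHAR char_p by simp
  also have "\<dots> = of_nat (nat (z mod int p))"
    using p0 by (simp add: of_nat_nat)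
  finally have "(of_int z :: 'k) = of_nat (nat (z mod int p))" .
  then show ?case using nat by metis
qed

lemma poly_frobenius_power:
  fixes q :: "'k poly"
  assumes "\<forall>i. Polynomial.coeff q i \<in> \<int>"
  shows "poly q (x ^ (p ^ i)) = poly q x ^ (p ^ i)"
proof -
  have "poly q x ^ (p ^ i) = (\<Sum>j\<le>degree q. (Polynomial.coeff q j * x ^ j) ^ (p ^ i))"
    unfolding poly_altdef
    using freshmans_dream_sum'[of "p ^ i" i "\<lambda>j. Polynomial.coeff q j * x ^ j" "{..degree q}"]
      prime_p char_p by simp
  also have "\<dots> = poly q (x ^ (p ^ i))"
    unfolding poly_altdef
    by (intro sum.cong refl)
      (use assms in \<open>simp add: power_mult_distrib frobenius_power_of_int mult.commute flip: power_mult\<close>)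
  finally show ?thesis ..
qed

text \<open>The Frobenius orbit of \<open>x\<close> consists of roots of a polynomial over the prime field.\<close>

lemma ex_frobenius_period:
  fixes x :: 'k
  assumes "algebraic_over_prime_field x"
  shows "\<exists>m>0. x ^ (p ^ m) = x"
proof -
  obtain q :: "'k poly" where q: "q \<noteq> 0" "\<forall>i. Polynomial.coeff q i \<in> \<int>" "poly q x = 0"
    using assms unfolding algebraic_over_prime_field_def by blast
  have "poly q (x ^ (p ^ i)) = 0" for i
    using poly_frobenius_power[OF q(2)] q(3) prime_p by (simp add: power_0_left prime_gt_0_nat)
  then have "finite (range (\<lambda>i. x ^ (p ^ i)))"
    by (intro finite_subset[OF _ poly_roots_finite[OF q(1)]]) auto
  then have "\<not> inj (\<lambda>i. x ^ (p ^ i))"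
    using finite_imageD by blast
  then obtain i j where ij: "i < j" "x ^ (p ^ i) = x ^ (p ^ j)"
    unfolding inj_def by (metis linorder_neqE_nat)
  have "(x ^ (p ^ (j - i))) ^ (p ^ i) = x ^ (p ^ j)"
    using ij(1) by (simp flip: power_mult power_add)
  \<comment> \<open>Injectivity of Frobenius makes the orbit purely periodic, not just eventually
    periodic.\<close>
  then have "x ^ (p ^ (j - i)) = x"
    using ij(2) frobenius_power_inj by metis
  then show ?thesis using ij(1) by (intro exI[of _ "j - i"]) simp
qed

lemma frobenius_power_mod_period:
  fixes x :: 'k
  assumes "x ^ (p ^ m) = x"
  shows "x ^ (p ^ a) = x ^ (p ^ (a mod m))"
proof -
  have *: "x ^ (p ^ (m * b)) = x" for b
    by (induction b) (simp_all add: power_add power_mult assms)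
  have "x ^ (p ^ a) = x ^ (p ^ (m * (a div m) + a mod m))" by simp
  also have "\<dots> = (x ^ (p ^ (m * (a div m)))) ^ (p ^ (a mod m))"
    by (simp only: power_add power_mult)
  finally show ?thesis using * by simp
qed

text \<open>If \<open>x\<close> has Frobenius period \<open>m\<close>, then
  \<open>x ^ (p ^ a n)\<close> depends only on \<open>a n mod m\<close> and is eventually constant.
  The identities valid for Frobenius powers pass to the limit.\<close>

lemma ex_Gal_limit_frobenius_powers:
  fixes a :: "nat \<Rightarrow> nat"
  assumes alg: "\<forall>x::'k. algebraic_over_prime_field x"
    and conv: "\<forall>m>0. \<exists>c. \<forall>\<^sub>F n in sequentially. a n mod m = c"
  shows "\<exists>\<sigma>\<in>Gal_prime_field. \<forall>x::'k. \<forall>\<^sub>F n in sequentially. \<sigma> x = x ^ (p ^ a n)"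
proof -
  \<comment> \<open>One exponent serves all \<open>y\<close> of period \<open>m\<close>;
    surjectivity uses this uniformity.\<close>
  have "\<exists>c. \<forall>y::'k. y ^ (p ^ m) = y \<longrightarrow> (\<forall>\<^sub>F n in sequentially. y ^ (p ^ c) = y ^ (p ^ a n))"
    if "m > 0" for m
  proof -
    obtain c where c: "\<forall>\<^sub>F n in sequentially. a n mod m = c" using conv \<open>m > 0\<close> by blast
    show ?thesis
      by (intro exI[of _ c] allI impI eventually_mono[OF c])
        (metis frobenius_power_mod_period)
  qed
  then obtain f where f: "\<And>m y. m > 0 \<Longrightarrow> (y::'k) ^ (p ^ m) = y \<Longrightarrow>
      \<forall>\<^sub>F n in sequentially. y ^ (p ^ f m) = y ^ (p ^ a n)"
    by metis
  have "\<forall>x::'k. \<exists>y. \<forall>\<^sub>F n in sequentially. y = x ^ (p ^ a n)"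
    using f ex_frobenius_period alg by blast
  then obtain \<sigma> :: "'k \<Rightarrow> 'k" where \<sigma>: "\<And>x. \<forall>\<^sub>F n in sequentially. \<sigma> x = x ^ (p ^ a n)"
    by metis
  have eqI: "y = z" if "\<forall>\<^sub>F n in sequentially. y = z" for y z :: 'k
    using that by simp
  have add: "\<sigma> (x + y) = \<sigma> x + \<sigma> y" for x y
    by (rule eqI, use \<sigma>[of "x + y"] \<sigma>[of x] \<sigma>[of y] in eventually_elim)
      (simp add: frobenius_power_add)
  have mult: "\<sigma> (x * y) = \<sigma> x * \<sigma> y" for x y
    by (rule eqI, use \<sigma>[of "x * y"] \<sigma>[of x] \<sigma>[of y] in eventually_elim)
      (simp add: power_mult_distrib)
  have Ints: "\<sigma> c = c" if "c \<in> \<int>" for c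
    by (rule eqI, use \<sigma>[of c] in eventually_elim) (simp add: frobenius_power_of_int that)
  have inj: "x = y" if "\<sigma> x = \<sigma> y" for x y
  proof -
    have "\<forall>\<^sub>F n in sequentially. x = y"
      using \<sigma>[of x] \<sigma>[of y]
      by eventually_elim (metis that frobenius_power_inj)
    then show ?thesis by (rule eqI)
  qed
  have surj: "\<exists>y. \<sigma> y = x" for x
  proof -
    obtain m where m: "m > 0" "x ^ (p ^ m) = x" using ex_frobenius_period alg by blast
    \<comment> \<open>On elements of period \<open>m\<close> the limit is the
      \<open>f m\<close>-fold Frobenius; the \<open>b\<close>-fold one inverts it, as
      \<open>b + f m\<close> is a multiple of \<open>m\<close>.\<close>
    define b where "b = (m - 1) * f m"
    define y where "y = x ^ (p ^ b)"
    have "y ^ (p ^ m) = (x ^ (p ^ m)) ^ (p ^ b)"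
      unfolding y_def by (simp add: mult.commute flip: power_mult)
    then have "y ^ (p ^ m) = y" using m(2) y_def by simp
    then have "\<forall>\<^sub>F n in sequentially. y ^ (p ^ f m) = y ^ (p ^ a n)"
      using f m(1) by blast
    then have "\<forall>\<^sub>F n in sequentially. \<sigma> y = y ^ (p ^ f m)"
      using \<sigma>[of y] by eventually_elim simp
    then have "\<sigma> y = y ^ (p ^ f m)" by (rule eqI)
    also have "\<dots> = x ^ (p ^ (b + f m))"
      unfolding y_def by (simp add: power_add flip: power_mult)
    also have "b + f m = m * f m"
      unfolding b_def using m(1) by (cases m) auto
    also have "x ^ (p ^ (m * f m)) = x"
      using frobenius_power_mod_period[OF m(2), of "m * f m"] by simp
    finally show ?thesis ..
  qed
  have "bij \<sigma>"
    using inj surj by (intro bijI injI) (auto simp: surj_def, metis)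
  then have "\<sigma> \<in> Gal_prime_field"
    unfolding Gal_prime_field_def using add mult Ints by auto
  then show ?thesis using \<sigma> by blast
qed

end

section \<open>Annihilating the \<open>l\<close>-primary torsion\<close>

lemma power_eq_power_if_cong:
  fixes x :: "'a::monoid_mult"
  assumes "x ^ N = 1" and "[i = j] (mod N)"
  shows "x ^ i = x ^ j"
proof -
  have *: "x ^ i = x ^ (i mod N)" for i
  proof -
    have "x ^ i = x ^ (N * (i div N) + i mod N)" by simp
    also have "\<dots> = (x ^ N) ^ (i div N) * x ^ (i mod N)"
      by (simp only: power_add power_mult)
    finally show ?thesis using assms(1) by simp
  qed
  show ?thesis
    using *[of i] *[of j] assms(2) by (simp add: cong_def)
qed

theorem theorem1:
  fixes p l :: nat
  assumes "prime p"
    and "CHAR('k::alg_closed_field) = p"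
    and "\<forall>x::'k. algebraic_over_prime_field x"
    and "prime l" and "l \<noteq> p"
  shows "\<exists>(\<sigma> :: 'k \<Rightarrow> 'k) \<in> Gal_prime_field. \<exists>P :: int poly.
           modular_poly p P \<and> Gm_primary_torsion l \<subseteq> ker_poly_endo P \<sigma>"
proof -
  obtain k where k: "\<And>u n. [u = 1] (mod l ^ k) \<Longrightarrow> \<exists>a. [p ^ a = u] (mod l ^ n)"
    using ex_power_cong_primes[OF assms(1,4,5)] by blast
  \<comment> \<open>The factor \<open>l ^ k\<close> puts \<open>u\<close> within reach of powers of
    \<open>p\<close>; the factor \<open>p\<close> makes it prime to \<open>p\<close>.\<close>
  define u where "u = 1 + p * l ^ k"
  have "[u = 1] (mod l ^ k)"
    unfolding u_def by (metis cong_0_iff cong_add_lcancel_0_nat dvd_triv_right)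
  then obtain a where a: "\<And>n. [p ^ a n = u] (mod l ^ n)"
    using k by metis
  \<comment> \<open>The exponents are controlled only through \<open>p ^ a n\<close> modulo
    \<open>l ^ n\<close>; a limit on the whole field needs their residues to stabilize for every
    modulus.\<close>
  obtain r where r: "strict_mono r"
      "\<forall>m>0. \<exists>c. \<forall>\<^sub>F n in sequentially. a (r n) mod m = c"
    using ex_subseq_eventually_const_mod[of a] by blast
  obtain \<sigma> :: "'k \<Rightarrow> 'k" where \<sigma>: "\<sigma> \<in> Gal_prime_field"
      "\<And>x. \<forall>\<^sub>F n in sequentially. \<sigma> x = x ^ (p ^ a (r n))"
    using ex_Gal_limit_frobenius_powers[OF assms(1,2,3) r(2)] by blast
  have "u > 1"
    unfolding u_def using assms(1,4) prime_gt_0_nat by simp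
  moreover have "\<not> p dvd u"
    unfolding u_def using assms(1) by (metis dvd_add_left_iff dvd_triv_left not_prime_unit)
  ultimately have "modular_poly p [:- int u, 1:]"
    by (rule modular_poly_linear[OF assms(1)])
  moreover have "x \<in> ker_poly_endo [:- int u, 1:] \<sigma>" if "x \<in> Gm_primary_torsion l" for x
  proof -
    obtain n where x: "x \<noteq> 0" "x ^ (l ^ n) = 1"
      using \<open>x \<in> Gm_primary_torsion l\<close> unfolding Gm_primary_torsion_def by blast
    have "\<forall>\<^sub>F i in sequentially. i \<ge> n" by (rule eventually_ge_at_top)
    then have "\<forall>\<^sub>F i in sequentially. \<sigma> x = x ^ u"
      using \<sigma>(2)[of x]
    proof eventually_elim
      case (elim i)
      \<comment> \<open>A strictly increasing \<open>r\<close> satisfies \<open>r i \<ge> i\<close>,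
        and \<open>i \<ge> n\<close>.\<close>
      have "l ^ n dvd l ^ r i"
        using elim(1) seq_suble[OF r(1), of i] by (intro le_imp_power_dvd) simp
      then have "[p ^ a (r i) = u] (mod l ^ n)"
        using a cong_dvd_modulus_nat by blast
      then show ?case
        using power_eq_power_if_cong[OF x(2)] elim(2) by simp
    qed
    then have "\<sigma> x = x ^ u" by simp
    then show ?thesis
      using x(1) by (simp add: ker_poly_endo_def poly_endo_def power_int_minus)
  qed
  ultimately show ?thesis using \<sigma>(1) by blast
qed

end
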